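(* A move of type III cannot be generated by moves of types I, II, IV, and V; that is, for $m\in\mathcal{R}_{III}$, it is not the case that $m\prec \mathcal{R}_I\cup\mathcal{R}_{II}\cup\mathcal{R}_{IV}\cup\mathcal{R}_V$.
   Context: An oriented singular tangle diagram in a disk is a generic immersion of finitely many oriented circles and properly immersed oriented arcs, whose only multiple points are transverse double points, each being either a real crossing (with over/under information) or a singular crossing (without over/under information). Diagrams are considered up to planar isotopy (fixing the boundary of the disk). A local move is a replacement, usable in both directions, of one diagram in a disk by another with the same oriented boundary points; it may be applied inside any embedded oriented disk (changing disk) of a larger diagram. Moves differing only by an orientation-preserving homeomorphism of the disk (and by exchanging the two sides) are the same move. Oriented moves: - Type I: an arc without crossing $\leftrightarrow$ an arc with one kink having a single real crossing (4 oriented moves, forming the set $\mathcal{R}_I$). - Type II: two disjoint arcs $\leftrightarrow$ two arcs meeting in two consecutive real crossings bounding a bigon, one arc passing over the other at both (4 oriented moves, forming $\mathcal{R}_{II}$). - Type III: three arcs pairwise crossing once at real crossings (a top, a middle and a bottom arc) bounding a triangle $\leftrightarrow$ the diagram after one arc is slid across the crossing of the other two (8 oriented moves, forming $\mathcal{R}_{III}$). - Type IV: two arcs meeting at one singular crossing, and a third arc crossing both of them at real crossings, passing over both or under both, on one side of the singular crossing $\leftrightarrow$ the same with the third arc slid across the singular crossing to the opposite side (8 oriented moves, forming $\mathcal{R}_{IV}$). - Type V: two arcs meeting in one singular crossing followed by one real crossing (the two crossings bounding a bigon) $\leftrightarrow$ the same with the order of the two crossings exchanged; i.e. as 2-strand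 tangles, $\tau\sigma^{\varepsilon}\leftrightarrow\sigma^{\varepsilon}\tau$, with $\tau$ the singular crossing, $\sigma^{\pm1}$ the real crossings, and any orientations of the two strands (6 oriented moves, forming $\mathcal{R}_V$). A local move $m$ supported in a disk $B$ is generated by a set $S$ of local moves, written $m\prec S$, if the change prescribed by $m$ can be achieved by a finite sequence of moves from $S$ (and planar isotopies), all performed within $B$ and without affecting the diagram outside $B$. *)

theory Defs
  imports "HOL-Analysis.Analysis"
begin

text \<open>
  A singular tangle diagram is given by the immersion itself. Its source is a disjoint union of
  copies of the interval \<open>[0,1]\<close> (labelled by \<open>arcs\<close>) and of the circle \<open>\<real>/\<int>\<close> (labelled by
  \<open>circles\<close>); \<open>curve i\<close> is the immersion of the component \<open>i\<close>, 1-periodic for a circle. Increasing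
  parameter is the orientation. The set \<open>over\<close> contains the upper preimage of every real crossing;
  a double point neither of whose preimages is in \<open>over\<close> is a singular crossing.
\<close>

record tdiagram =
  arcs :: "nat set"
  circles :: "nat set"
  curve :: "nat \<Rightarrow> real \<Rightarrow> complex"
  over :: "(nat \<times> real) set"

definition points :: "tdiagram \<Rightarrow> (nat \<times> real) set" where
  "points D = arcs D \<times> {0..1} \<union> circles D \<times> {0..<1}"

definition image_pt :: "tdiagram \<Rightarrow> nat \<times> real \<Rightarrow> complex" where
  "image_pt D x = curve D (fst x) (snd x)"

definition crossings :: "tdiagram \<Rightarrow> (nat \<times> real) set set" where
  "crossings D = {{x, y} | x y. x \<in> points D \<and> y \<in> points D \<and> x \<noteq> y \<and> image_pt D x = image_pt D y}"

definition param_range :: "tdiagram \<Rightarrow> nat \<Rightarrow> real set" where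
  "param_range D i = (if i \<in> arcs D then {0..1} else UNIV)"

definition velocity :: "tdiagram \<Rightarrow> nat \<times> real \<Rightarrow> complex" where
  "velocity D x = vector_derivative (curve D (fst x)) (at (snd x) within param_range D (fst x))"

text \<open>Here \<open>d n\<close> is the \<open>n\<close>-th derivative (one-sided at the ends of an interval).\<close>

definition smooth_curve :: "real set \<Rightarrow> (real \<Rightarrow> complex) \<Rightarrow> bool" where
  "smooth_curve I g \<longleftrightarrow>
     (\<exists>d. d 0 = g \<and> (\<forall>n. \<forall>t\<in>I. (d n has_vector_derivative d (Suc n) t) (at t within I)))"

definition disk :: "complex set \<Rightarrow> bool" where
  "disk B \<longleftrightarrow> B homeomorphic cball (0::complex) 1"

text \<open>
  The finiteness of \<open>crossings D\<close> is redundant: it follows from transversality by compactness.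
\<close>

definition diagram :: "complex set \<Rightarrow> tdiagram \<Rightarrow> bool" where
  "diagram B D \<longleftrightarrow>
     finite (arcs D) \<and> finite (circles D) \<and> arcs D \<inter> circles D = {} \<and>
     (\<forall>i\<in>arcs D \<union> circles D. smooth_curve (param_range D i) (curve D i)) \<and>
     (\<forall>i\<in>circles D. \<forall>t. curve D i (t + 1) = curve D i t) \<and>
     (\<forall>x\<in>points D. velocity D x \<noteq> 0) \<and>
     (\<forall>i\<in>arcs D. \<forall>t\<in>{0..1}. curve D i t \<in> B \<and>
        (curve D i t \<in> frontier B \<longleftrightarrow> t = 0 \<or> t = 1)) \<and>
     (\<forall>i\<in>circles D. \<forall>t. curve D i t \<in> interior B) \<and>
     finite (crossings D) \<and>
     (\<forall>x\<in>points D. \<forall>y\<in>points D. x \<noteq> y \<and> image_pt D x = image_pt D y \<longrightarrow>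
        image_pt D x \<in> interior B \<and>
        \<not> collinear {0, velocity D x, velocity D y} \<and>
        (\<forall>z\<in>points D. image_pt D z = image_pt D x \<longrightarrow> z = x \<or> z = y)) \<and>
     (\<forall>x\<in>over D. \<exists>y. {x, y} \<in> crossings D \<and> y \<notin> over D)"


text \<open>
  \<open>embeds c \<phi> E D X\<close>: the component map \<open>c\<close> and the increasing parameter changes \<open>\<phi>\<close> give an
  orientation-preserving homeomorphism from the source of \<open>E\<close> onto the subset \<open>X\<close> of the source of
  \<open>D\<close>, under which \<open>E\<close> is the restriction of \<open>D\<close> to \<open>X\<close>. For components of \<open>D\<close> which are circles,
  \<open>\<phi>\<close> takes values in the universal cover \<open>\<real>\<close>.
\<close>

definition place :: "tdiagram \<Rightarrow> (nat \<Rightarrow> nat) \<Rightarrow> (nat \<Rightarrow> real \<Rightarrow> real) \<Rightarrow> nat \<times> real \<Rightarrow> nat \<times> real" where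
  "place D c \<phi> x =
     (c (fst x),
      if c (fst x) \<in> circles D then frac (\<phi> (fst x) (snd x)) else \<phi> (fst x) (snd x))"

definition embeds ::
    "(nat \<Rightarrow> nat) \<Rightarrow> (nat \<Rightarrow> real \<Rightarrow> real) \<Rightarrow> tdiagram \<Rightarrow> tdiagram \<Rightarrow> (nat \<times> real) set \<Rightarrow> bool" where
  "embeds c \<phi> E D X \<longleftrightarrow>
     bij_betw (place D c \<phi>) (points E) X \<and> X \<subseteq> points D \<and>
     (\<forall>k\<in>arcs E. continuous_on {0..1} (\<phi> k) \<and> strict_mono_on {0..1} (\<phi> k)) \<and>
     (\<forall>k\<in>circles E. c k \<in> circles D \<and> continuous_on UNIV (\<phi> k) \<and> strict_mono (\<phi> k) \<and>
        (\<forall>t. \<phi> k (t + 1) = \<phi> k t + 1)) \<and>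
     (\<forall>x\<in>points E. image_pt E x = image_pt D (place D c \<phi> x) \<and>
        (x \<in> over E \<longleftrightarrow> place D c \<phi> x \<in> over D))"

definition reparametrized :: "tdiagram \<Rightarrow> tdiagram \<Rightarrow> bool" where
  "reparametrized D D' \<longleftrightarrow> (\<exists>c \<phi>. embeds c \<phi> D' D (points D))"

definition planar_isotopic :: "complex set \<Rightarrow> tdiagram \<Rightarrow> tdiagram \<Rightarrow> bool" where
  "planar_isotopic B D D' \<longleftrightarrow>
     arcs D' = arcs D \<and> circles D' = circles D \<and> over D' = over D \<and>
     (\<exists>H :: real \<Rightarrow> complex \<Rightarrow> complex.
        continuous_on ({0..1} \<times> B) (\<lambda>(s, z). H s z) \<and>
        (\<forall>s\<in>{0..1}. \<exists>G. homeomorphism B B (H s) G) \<and>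
        (\<forall>z\<in>B. H 0 z = z) \<and>
        (\<forall>s\<in>{0..1}. \<forall>z\<in>frontier B. H s z = z) \<and>
        (\<forall>x\<in>points D. image_pt D' x = H 1 (image_pt D x)))"


text \<open>
  A move is a triple of a disk and the two diagrams in it. None of the moves considered changes
  which boundary points are joined, so the two diagrams are taken as immersions of the same
  source, agreeing at the ends of each arc.
\<close>

type_synonym local_move = "complex set \<times> tdiagram \<times> tdiagram"

definition replacement :: "complex set \<Rightarrow> tdiagram \<Rightarrow> tdiagram \<Rightarrow> bool" where
  "replacement B E E' \<longleftrightarrow>
     disk B \<and> diagram B E \<and> diagram B E' \<and>
     arcs E' = arcs E \<and> circles E' = circles E \<and>
     (\<forall>i\<in>arcs E. curve E' i 0 = curve E i 0 \<and> curve E' i 1 = curve E i 1)"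

definition R_I :: "local_move set" where
  "R_I = {(B, E, E'). replacement B E E' \<and> circles E = {} \<and>
     (\<exists>a s t. arcs E = {a} \<and> crossings E = {} \<and>
        crossings E' = {{(a, s), (a, t)}} \<and> over E' = {(a, s)})}"

definition R_II :: "local_move set" where
  "R_II = {(B, E, E'). replacement B E E' \<and> circles E = {} \<and>
     (\<exists>a b s t s' t'. a \<noteq> b \<and> s \<noteq> s' \<and> arcs E = {a, b} \<and> crossings E = {} \<and>
        crossings E' = {{(a, s), (b, t)}, {(a, s'), (b, t')}} \<and>
        over E' = {(a, s), (a, s')})}"

text \<open>
  Three arcs crossing pairwise exactly once; \<open>p a b\<close> is the parameter at which the arc \<open>a\<close> meets
  the arc \<open>b\<close>. Such arcs always bound a triangle, and sliding one of them across the crossing of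
  the other two means that on each arc the two crossings change their order.
\<close>

definition triangle :: "tdiagram \<Rightarrow> nat \<Rightarrow> nat \<Rightarrow> nat \<Rightarrow> (nat \<Rightarrow> nat \<Rightarrow> real) \<Rightarrow> bool" where
  "triangle E x y z p \<longleftrightarrow>
     crossings E = {{(x, p x y), (y, p y x)}, {(x, p x z), (z, p z x)}, {(y, p y z), (z, p z y)}}"

definition slid :: "nat \<Rightarrow> nat \<Rightarrow> nat \<Rightarrow> (nat \<Rightarrow> nat \<Rightarrow> real) \<Rightarrow> (nat \<Rightarrow> nat \<Rightarrow> real) \<Rightarrow> bool" where
  "slid x y z p q \<longleftrightarrow>
     (p x y < p x z \<longleftrightarrow> q x z < q x y) \<and>
     (p y x < p y z \<longleftrightarrow> q y z < q y x) \<and>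
     (p z x < p z y \<longleftrightarrow> q z y < q z x)"

definition R_III :: "local_move set" where
  "R_III = {(B, E, E'). replacement B E E' \<and> circles E = {} \<and>
     (\<exists>x y z p q. distinct [x, y, z] \<and> arcs E = {x, y, z} \<and>
        triangle E x y z p \<and> triangle E' x y z q \<and> slid x y z p q \<and>
        over E = {(x, p x y), (x, p x z), (y, p y z)} \<and>
        over E' = {(x, q x y), (x, q x z), (y, q y z)})}"

definition R_IV :: "local_move set" where
  "R_IV = {(B, E, E'). replacement B E E' \<and> circles E = {} \<and>
     (\<exists>x y z p q. distinct [x, y, z] \<and> arcs E = {x, y, z} \<and>
        triangle E x y z p \<and> triangle E' x y z q \<and> slid x y z p q \<and>
        (over E = {(x, p x y), (x, p x z)} \<and> over E' = {(x, q x y), (x, q x z)} \<or>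
         over E = {(y, p y x), (z, p z x)} \<and> over E' = {(y, q y x), (z, q z x)}))}"

text \<open>
  The real crossing has the parameters \<open>r\<close>, the singular one the parameters \<open>w\<close>. In
  \<open>\<tau>\<sigma>\<^sup>\<epsilon> \<leftrightarrow> \<sigma>\<^sup>\<epsilon>\<tau>\<close> the exponent is kept; as the strands trade places at \<open>\<tau>\<close>, the upper strand of
  \<open>\<sigma>\<^sup>\<epsilon>\<close> on one side is the lower strand on the other side.
\<close>

definition R_V :: "local_move set" where
  "R_V = {(B, E, E'). replacement B E E' \<and> circles E = {} \<and>
     (\<exists>a b r w r' w'. a \<noteq> b \<and> arcs E = {a, b} \<and>
        r a \<noteq> w a \<and> r' a \<noteq> w' a \<and>
        crossings E = {{(a, r a), (b, r b)}, {(a, w a), (b, w b)}} \<and>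
        crossings E' = {{(a, r' a), (b, r' b)}, {(a, w' a), (b, w' b)}} \<and>
        (r a < w a \<longleftrightarrow> w' a < r' a) \<and> (r b < w b \<longleftrightarrow> w' b < r' b) \<and>
        over E = {(a, r a)} \<and> over E' = {(b, r' b)})}"


definition move_inside :: "local_move set \<Rightarrow> complex set \<Rightarrow> tdiagram \<Rightarrow> tdiagram \<Rightarrow> bool" where
  "move_inside S B D D' \<longleftrightarrow>
     arcs D' = arcs D \<and> circles D' = circles D \<and>
     (\<exists>B' E E' c \<phi>. disk B' \<and> B' \<subseteq> B \<and> ((B', E, E') \<in> S \<or> (B', E', E) \<in> S) \<and>
        embeds c \<phi> E D {x \<in> points D. image_pt D x \<in> B'} \<and>
        embeds c \<phi> E' D' {x \<in> points D'. image_pt D' x \<in> B'} \<and>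
        (\<forall>x\<in>points D. image_pt D x \<notin> B' \<longrightarrow>
           image_pt D' x = image_pt D x \<and> (x \<in> over D' \<longleftrightarrow> x \<in> over D)))"

definition step :: "local_move set \<Rightarrow> complex set \<Rightarrow> tdiagram \<Rightarrow> tdiagram \<Rightarrow> bool" where
  "step S B D D' \<longleftrightarrow>
     diagram B D \<and> diagram B D' \<and>
     (reparametrized D D' \<or> planar_isotopic B D D' \<or> move_inside S B D D')"

definition generated_by :: "local_move \<Rightarrow> local_move set \<Rightarrow> bool" (infix "\<prec>" 50) where
  "m \<prec> S \<longleftrightarrow> (case m of (B, E, E') \<Rightarrow> (step S B)\<^sup>*\<^sup>* E E')"

end

theory Submission
  imports Defs
begin

text \<open>
  All three arcs of a type III move cross at real crossings only. Moves of types IV and V carry a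
  singular crossing on both of their sides, and moves of types I and II carry none, so a diagram
  without singular crossings stays without them and admits moves of types I and II only
  (\<open>type_IV_not_all_real\<close>, \<open>type_V_not_all_real\<close>, \<open>local_replacement.all_real_transfer\<close>).

  It remains to separate the two sides of a type III move up to moves of types I and II. Travel
  along one of the three arcs, say \<open>x\<close>, and write the letter \<open>y\<close> or \<open>z\<close> at each crossing with the
  arc \<open>y\<close> or \<open>z\<close>. A move of type I creates a self-crossing, which is not recorded; a move of type
  II inserts or deletes at most one pair of equal adjacent letters. Hence the word is invariant as
  an element of the free product of two groups of order two. The slide in a type III move
  exchanges the words \<open>yz\<close> and \<open>zy\<close>, and these are different elements.

  Instead of the free product, an integer separates the two words: the number of letters \<open>y\<close> in
  odd positions minus the number of those in even positions. Two equal adjacent letters do not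
  change it (\<open>alternating_count_adjacent_left\<close>, \<open>alternating_count_adjacent_right\<close>), but it is \<open>1\<close>
  for \<open>yz\<close> and \<open>-1\<close> for \<open>zy\<close>. Since reparametrizations may permute the labels of the arcs, the
  arcs are recognised by their starting points on the boundary of the disk, which nothing moves.
\<close>

section \<open>The alternating count of a two-letter word\<close>

text \<open>
  A word in two letters is given by the disjoint sets \<open>A\<close> and \<open>C\<close> of the times at which the first
  and the second letter are read.
\<close>

definition alternating_count :: "real set \<Rightarrow> real set \<Rightarrow> int" where
  "alternating_count A C = (\<Sum>t\<in>A. (- 1) ^ card {s \<in> A \<union> C. s < t})"

lemma alternating_count_singletons:
  assumes "a \<noteq> b"
  shows "alternating_count {a} {b} = (if a < b then 1 else - 1)"
proof -
  have "{s \<in> {a} \<union> {b}. s < a} = (if a < b then {} else {b})"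
    using assms by auto
  then show ?thesis
    by (simp add: alternating_count_def)
qed

lemma alternating_count_strict_mono_image:
  assumes f: "strict_mono_on I f" and sub: "A \<subseteq> I" "C \<subseteq> I"
  shows "alternating_count (f ` A) (f ` C) = alternating_count A C"
proof -
  have inj: "inj_on f I"
    using f by (rule strict_mono_on_imp_inj_on)
  have "card {s \<in> f ` A \<union> f ` C. s < f t} = card {s \<in> A \<union> C. s < t}" if t: "t \<in> A" for t
  proof -
    have "f s < f t \<longleftrightarrow> s < t" if "s \<in> A \<union> C" for s
      using strict_mono_on_less[OF f, of s t] t that sub by auto
    then have "{s \<in> f ` A \<union> f ` C. s < f t} = f ` {s \<in> A \<union> C. s < t}"
      by auto
    moreover have "inj_on f {s \<in> A \<union> C. s < t}"
      by (rule inj_on_subset[OF inj]) (use sub in auto)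
    ultimately show ?thesis
      by (simp add: card_image)
  qed
  moreover have "inj_on f A"
    by (rule inj_on_subset[OF inj sub(1)])
  ultimately show ?thesis
    by (simp add: alternating_count_def sum.reindex)
qed

text \<open>
  Two letters inserted next to each other shift the positions of the other letters by \<open>0\<close> or \<open>2\<close>.
\<close>

lemma sign_insert_adjacent:
  fixes u v t :: real
  assumes fin: "finite S" and "u < v" and gap: "S \<inter> {u..v} = {}" and t: "t \<in> S"
  shows "(- 1 :: int) ^ card {s \<in> S \<union> {u, v}. s < t} = (- 1) ^ card {s \<in> S. s < t}"
proof -
  have "t \<notin> {u..v}"
    using gap t by blast
  then have "t < u \<or> v < t"
    by auto
  then show ?thesis
  proof
    assume "t < u"
    then have "{s \<in> S \<union> {u, v}. s < t} = {s \<in> S. s < t}"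
      using \<open>u < v\<close> by auto
    then show ?thesis
      by simp
  next
    assume "v < t"
    then have "{s \<in> S \<union> {u, v}. s < t} = insert u (insert v {s \<in> S. s < t})"
      using \<open>u < v\<close> by auto
    moreover have "u \<notin> insert v {s \<in> S. s < t}" "v \<notin> {s \<in> S. s < t}"
      using gap \<open>u < v\<close> by auto
    ultimately show ?thesis
      using fin by simp
  qed
qed

lemma alternating_count_adjacent_right:
  assumes "finite A" "finite C" "u < v" "(A \<union> C) \<inter> {u..v} = {}"
  shows "alternating_count A (C \<union> {u, v}) = alternating_count A C"
  unfolding alternating_count_def
  using sign_insert_adjacent[of "A \<union> C" u v] assms
  by (intro sum.cong) (simp_all add: Un_assoc)

text \<open>
  The two new terms have consecutive positions, hence opposite signs.
\<close>

lemma alternating_count_adjacent_left: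
  assumes fin: "finite A" "finite C" and uv: "u < v" and gap: "(A \<union> C) \<inter> {u..v} = {}"
  shows "alternating_count (A \<union> {u, v}) C = alternating_count A C"
proof -
  let ?S = "A \<union> C"
  let ?sign = "\<lambda>t. (- 1 :: int) ^ card {s \<in> ?S \<union> {u, v}. s < t}"
  have new: "A \<inter> {u, v} = {}"
    using gap uv by auto
  have "{s \<in> ?S \<union> {u, v}. s < v} = insert u {s \<in> ?S \<union> {u, v}. s < u}"
    using gap uv by force
  then have cancel: "?sign v = - ?sign u"
    using fin by simp
  have "(A \<union> {u, v}) \<union> C = ?S \<union> {u, v}"
    by auto
  then have "alternating_count (A \<union> {u, v}) C = (\<Sum>t\<in>A \<union> {u, v}. ?sign t)"
    by (simp only: alternating_count_def)
  also have "\<dots> = (\<Sum>t\<in>A. ?sign t) + (\<Sum>t\<in>{u, v}. ?sign t)"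
    using fin new by (intro sum.union_disjoint) auto
  also have "(\<Sum>t\<in>{u, v}. ?sign t) = 0"
    using uv cancel by simp
  also have "(\<Sum>t\<in>A. ?sign t) = alternating_count A C"
    unfolding alternating_count_def
    using sign_insert_adjacent[of ?S u v] fin uv gap by (intro sum.cong) auto
  finally show ?thesis
    by simp
qed

section \<open>Crossings and meeting times\<close>

definition meeting_times :: "tdiagram \<Rightarrow> nat \<Rightarrow> nat \<Rightarrow> real set" where
  "meeting_times D i j = {t. \<exists>u. {(i, t), (j, u)} \<in> crossings D}"

definition all_real :: "tdiagram \<Rightarrow> bool" where
  "all_real D \<longleftrightarrow> (\<forall>e\<in>crossings D. e \<inter> over D \<noteq> {})"

lemma crossing_iff:
  "{u, v} \<in> crossings D \<longleftrightarrow>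
     u \<in> points D \<and> v \<in> points D \<and> u \<noteq> v \<and> image_pt D u = image_pt D v"
  unfolding crossings_def mem_Collect_eq doubleton_eq_iff by (metis (no_types))

lemma crossingE:
  assumes "e \<in> crossings D"
  obtains u v where "e = {u, v}" "{u, v} \<in> crossings D"
proof -
  obtain u v where "e = {u, v}"
    using assms unfolding crossings_def by blast
  then show ?thesis
    using assms that by blast
qed

lemma finite_meeting_times:
  assumes "finite (crossings D)"
  shows "finite (meeting_times D i j)"
proof (rule finite_subset)
  show "meeting_times D i j \<subseteq> snd ` \<Union> (crossings D)"
    unfolding meeting_times_def by force
  show "finite (snd ` \<Union> (crossings D))"
    using assms by (auto elim: crossingE)
qed

lemma meeting_times_subset:
  assumes "circles D = {}"
  shows "meeting_times D i j \<subseteq> {0..1}"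
  using assms by (auto simp: meeting_times_def crossing_iff points_def)

lemma diagram_arc:
  assumes "diagram B D" and i: "i \<in> arcs D" "t \<in> {0..1}"
  shows "curve D i t \<in> B" "curve D i t \<in> frontier B \<longleftrightarrow> t = 0 \<or> t = 1"
proof -
  have "\<forall>i\<in>arcs D. \<forall>t\<in>{0..1}. curve D i t \<in> B \<and>
      (curve D i t \<in> frontier B \<longleftrightarrow> t = 0 \<or> t = 1)"
    using assms(1) unfolding diagram_def by (elim conjE)
  then show "curve D i t \<in> B" "curve D i t \<in> frontier B \<longleftrightarrow> t = 0 \<or> t = 1"
    using i by simp_all
qed

lemma diagram_crossing:
  assumes "diagram B D" and uv: "{u, v} \<in> crossings D"
  shows "image_pt D u \<in> interior B"
    and "w \<in> points D \<Longrightarrow> image_pt D w = image_pt D u \<Longrightarrow> w = u \<or> w = v"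
proof -
  have "\<forall>x\<in>points D. \<forall>y\<in>points D. x \<noteq> y \<and> image_pt D x = image_pt D y \<longrightarrow>
        image_pt D x \<in> interior B \<and>
        \<not> collinear {0, velocity D x, velocity D y} \<and>
        (\<forall>z\<in>points D. image_pt D z = image_pt D x \<longrightarrow> z = x \<or> z = y)"
    using assms(1) unfolding diagram_def by (elim conjE)
  moreover have "u \<in> points D" "v \<in> points D" "u \<noteq> v \<and> image_pt D u = image_pt D v"
    using uv unfolding crossing_iff by simp_all
  ultimately have *: "image_pt D u \<in> interior B \<and>
        (\<forall>z\<in>points D. image_pt D z = image_pt D u \<longrightarrow> z = u \<or> z = v)"
    by meson
  show "image_pt D u \<in> interior B"
    using * by simp
  show "w = u \<or> w = v" if "w \<in> points D" "image_pt D w = image_pt D u"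
    using * that by simp
qed

lemma diagram_finite_crossings:
  assumes "diagram B D"
  shows "finite (crossings D)"
  using assms unfolding diagram_def by (elim conjE)

lemma no_triple_point:
  assumes "diagram B D" "{u, v} \<in> crossings D" "{u, w} \<in> crossings D"
  shows "v = w"
  using diagram_crossing(2)[OF assms(1,2), of w] assms(3) by (auto simp: crossing_iff)

lemma arc_start_inj:
  assumes D: "diagram B D" and ij: "i \<in> arcs D" "j \<in> arcs D"
    and eq: "curve D i 0 = curve D j 0"
  shows "i = j"
proof (rule ccontr)
  assume "i \<noteq> j"
  then have "{(i, 0), (j, 0)} \<in> crossings D"
    using ij eq by (auto simp: crossing_iff points_def image_pt_def)
  then have "curve D i 0 \<in> interior B"
    using diagram_crossing(1)[OF D, of "(i, 0)" "(j, 0)"] by (simp add: image_pt_def)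
  moreover have "curve D i 0 \<in> frontier B"
    using diagram_arc(2)[OF D ij(1)] by simp
  ultimately show False
    by (simp add: frontier_def)
qed

text \<open>
  Crossings are transported by an embedding because it is injective and preserves image points.
\<close>

lemma embeds_crossing_iff:
  assumes emb: "embeds c \<phi> E D X" and uv: "u \<in> points E" "v \<in> points E"
  shows "{place D c \<phi> u, place D c \<phi> v} \<in> crossings D \<longleftrightarrow> {u, v} \<in> crossings E"
proof -
  have bij: "bij_betw (place D c \<phi>) (points E) X" and "X \<subseteq> points D"
    and img: "\<forall>x\<in>points E. image_pt E x = image_pt D (place D c \<phi> x)"
    using emb unfolding embeds_def by auto
  then have "place D c \<phi> u \<in> points D" "place D c \<phi> v \<in> points D"
    using uv by (auto dest: bij_betwE)
  moreover have "place D c \<phi> u = place D c \<phi> v \<longleftrightarrow> u = v"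
    using bij uv by (auto simp: bij_betw_def inj_on_def)
  ultimately show ?thesis
    using img uv by (simp add: crossing_iff)
qed

lemma embeds_over_iff:
  assumes "embeds c \<phi> E D X" "u \<in> points E"
  shows "place D c \<phi> u \<in> over D \<longleftrightarrow> u \<in> over E"
  using assms unfolding embeds_def by auto

lemma embeds_all_real:
  assumes emb: "embeds c \<phi> E D X" and D: "all_real D"
  shows "all_real E"
  unfolding all_real_def
proof
  fix e assume "e \<in> crossings E"
  then obtain u v where e: "e = {u, v}" "{u, v} \<in> crossings E"
    by (rule crossingE)
  then have uv: "u \<in> points E" "v \<in> points E"
    by (auto simp: crossing_iff)
  have "{place D c \<phi> u, place D c \<phi> v} \<in> crossings D"
    using embeds_crossing_iff[OF emb uv] e by simp
  then have "{place D c \<phi> u, place D c \<phi> v} \<inter> over D \<noteq> {}"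
    using D unfolding all_real_def by blast
  then show "e \<inter> over E \<noteq> {}"
    using embeds_over_iff[OF emb] uv e by auto
qed

section \<open>The reading of an arc\<close>

text \<open>
  The word read along the arc that starts at \<open>P\<close> records its crossings with the arcs that start
  at \<open>Q\<close> and at \<open>R\<close>.
\<close>

definition has_reading :: "complex \<Rightarrow> complex \<Rightarrow> complex \<Rightarrow> int \<Rightarrow> tdiagram \<Rightarrow> bool" where
  "has_reading P Q R n D \<longleftrightarrow>
     circles D = {} \<and> all_real D \<and>
     (\<exists>x y z. x \<in> arcs D \<and> y \<in> arcs D \<and> z \<in> arcs D \<and> distinct [x, y, z] \<and>
        curve D x 0 = P \<and> curve D y 0 = Q \<and> curve D z 0 = R \<and>
        alternating_count (meeting_times D x y) (meeting_times D x z) = n)"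

text \<open>
  The ends of the arcs are the only points on the boundary of the disk. Hence a reparametrization
  maps each arc increasingly onto a whole arc, and start to start.
\<close>

lemma has_reading_reparametrized:
  assumes D: "diagram B D" and D': "diagram B D'" and rep: "reparametrized D D'"
    and reading: "has_reading P Q R n D"
  shows "has_reading P Q R n D'"
proof -
  obtain c \<phi> where emb: "embeds c \<phi> D' D (points D)"
    using rep unfolding reparametrized_def by auto
  have circ: "circles D = {}" and real: "all_real D"
    using reading unfolding has_reading_def by auto
  have circ': "circles D' = {}"
    using emb circ unfolding embeds_def by auto
  have pts: "points D = arcs D \<times> {0..1}" "points D' = arcs D' \<times> {0..1}"
    using circ circ' by (auto simp: points_def)
  have place_eq [simp]: "place D c \<phi> (k, t) = (c k, \<phi> k t)" for k t
    using circ by (simp add: place_def)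
  have bij: "bij_betw (place D c \<phi>) (arcs D' \<times> {0..1}) (arcs D \<times> {0..1})"
    and img: "\<And>k t. k \<in> arcs D' \<Longrightarrow> t \<in> {0..1} \<Longrightarrow> curve D' k t = curve D (c k) (\<phi> k t)"
    and mono: "\<And>k. k \<in> arcs D' \<Longrightarrow> strict_mono_on {0..1} (\<phi> k)"
    using emb pts unfolding embeds_def by (auto simp: image_pt_def)
  have rng: "c k \<in> arcs D \<and> \<phi> k t \<in> {0..1}" if "k \<in> arcs D'" "t \<in> {0..1}" for k t
    using bij_betwE[OF bij] that by fastforce
  have ends: "\<phi> k 0 = 0" if k: "k \<in> arcs D'" for k
  proof -
    have on_frontier: "\<phi> k t = 0 \<or> \<phi> k t = 1" if t: "t = 0 \<or> t = 1" for t
    proof -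
      have "curve D' k t \<in> frontier B"
        using diagram_arc(2)[OF D' k] t by auto
      then have "curve D (c k) (\<phi> k t) \<in> frontier B"
        using img k t by auto
      then show ?thesis
        using diagram_arc(2)[OF D] rng[OF k, of t] t by auto
    qed
    have "\<phi> k 0 < \<phi> k 1"
      using mono[OF k] by (auto simp: strict_mono_on_def)
    then show ?thesis
      using on_frontier[of 0] on_frontier[of 1] by auto
  qed
  have lift: "\<exists>k. k \<in> arcs D' \<and> c k = i" if "i \<in> arcs D" for i
  proof -
    have "(i, 0) \<in> place D c \<phi> ` (arcs D' \<times> {0..1})"
      using that bij by (simp add: bij_betw_def)
    then show ?thesis
      by (auto simp: place_def circ)
  qed
  have inj: "k = l" if "k \<in> arcs D'" "l \<in> arcs D'" "c k = c l" for k l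
  proof -
    have "place D c \<phi> (k, 0) = place D c \<phi> (l, 0)"
      using that ends by simp
    then show ?thesis
      using inj_onD[OF bij_betw_imp_inj_on[OF bij], of "(k, 0)" "(l, 0)"] that by auto
  qed
  have times: "meeting_times D (c k) (c l) = \<phi> k ` meeting_times D' k l"
    if kl: "k \<in> arcs D'" "l \<in> arcs D'" for k l
  proof (intro set_eqI iffI)
    fix t assume "t \<in> meeting_times D (c k) (c l)"
    then obtain u where tu: "{(c k, t), (c l, u)} \<in> crossings D"
      unfolding meeting_times_def by auto
    then have "(c k, t) \<in> place D c \<phi> ` (arcs D' \<times> {0..1})"
      "(c l, u) \<in> place D c \<phi> ` (arcs D' \<times> {0..1})"
      unfolding bij_betw_imp_surj_on[OF bij] pts(1)[symmetric] crossing_iff by simp_all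
    then obtain k' l' t' u'
      where k': "k' \<in> arcs D'" "t' \<in> {0..1}" "(c k, t) = place D c \<phi> (k', t')"
        and l': "l' \<in> arcs D'" "u' \<in> {0..1}" "(c l, u) = place D c \<phi> (l', u')"
      by (elim imageE SigmaE) blast
    then have "k' = k" "l' = l"
      using inj[of k' k] inj[of l' l] kl by simp_all
    then have "{(k, t'), (l, u')} \<in> crossings D'"
      using embeds_crossing_iff[OF emb, of "(k, t')" "(l, u')"] tu k' l' pts by simp
    then show "t \<in> \<phi> k ` meeting_times D' k l"
      using k'(3) \<open>k' = k\<close> unfolding meeting_times_def by auto
  next
    fix t assume "t \<in> \<phi> k ` meeting_times D' k l"
    then obtain t' u' where t: "t = \<phi> k t'" and cr: "{(k, t'), (l, u')} \<in> crossings D'"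
      unfolding meeting_times_def by auto
    then have "{(c k, t), (c l, \<phi> l u')} \<in> crossings D"
      using embeds_crossing_iff[OF emb, of "(k, t')" "(l, u')"] by (auto simp: crossing_iff)
    then show "t \<in> meeting_times D (c k) (c l)"
      unfolding meeting_times_def by auto
  qed
  obtain x y z where xyz: "x \<in> arcs D" "y \<in> arcs D" "z \<in> arcs D" "distinct [x, y, z]"
    "curve D x 0 = P" "curve D y 0 = Q" "curve D z 0 = R"
    and n: "alternating_count (meeting_times D x y) (meeting_times D x z) = n"
    using reading unfolding has_reading_def by auto
  obtain x' y' z' where k: "x' \<in> arcs D'" "y' \<in> arcs D'" "z' \<in> arcs D'"
    and c: "c x' = x" "c y' = y" "c z' = z"
    using lift xyz by metis
  have "alternating_count (meeting_times D' x' y') (meeting_times D' x' z') = n"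
    using alternating_count_strict_mono_image[OF mono[OF k(1)]
        meeting_times_subset[OF circ'] meeting_times_subset[OF circ'], of x' y' x' z']
      times[OF k(1) k(2)] times[OF k(1) k(3)] c n by simp
  moreover have "curve D' x' 0 = P" "curve D' y' 0 = Q" "curve D' z' 0 = R"
    using img[of _ 0] ends k c xyz by auto
  moreover have "distinct [x', y', z']"
    using c xyz by auto
  ultimately show ?thesis
    using k circ' embeds_all_real[OF emb real] unfolding has_reading_def by blast
qed

text \<open>
  The final map of an isotopy is injective and fixes the boundary, so it creates no double points,
  destroys none, and leaves the starting points where they are.
\<close>

lemma has_reading_planar_isotopic:
  assumes D: "diagram B D" and iso: "planar_isotopic B D D'"
    and reading: "has_reading P Q R n D"
  shows "has_reading P Q R n D'"
proof -
  have eqs: "arcs D' = arcs D" "circles D' = circles D" "over D' = over D"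
    using iso unfolding planar_isotopic_def by - (elim conjE, assumption)+
  obtain H :: "real \<Rightarrow> complex \<Rightarrow> complex"
    where homs: "\<forall>s\<in>{0..1}. \<exists>G. homeomorphism B B (H s) G"
      and fixes_frontier: "\<forall>s\<in>{0..1}. \<forall>z\<in>frontier B. H s z = z"
      and img: "\<forall>x\<in>points D. image_pt D' x = H 1 (image_pt D x)"
    using iso unfolding planar_isotopic_def by (elim conjE exE)
  obtain G where hom: "homeomorphism B B (H 1) G"
    using bspec[OF homs, of 1] by auto
  have fix_frontier: "\<forall>z\<in>frontier B. H 1 z = z"
    using fixes_frontier by simp
  have circ: "circles D = {}"
    using reading unfolding has_reading_def by auto
  have pts: "points D' = points D"
    using eqs by (simp add: points_def)
  have in_B: "image_pt D x \<in> B" if "x \<in> points D" for x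
    using diagram_arc(1)[OF D] circ that by (auto simp: points_def image_pt_def)
  have "H 1 z = H 1 w \<longleftrightarrow> z = w" if "z \<in> B" "w \<in> B" for z w
    using hom that unfolding homeomorphism_def by metis
  then have same_double_points: "image_pt D' x = image_pt D' y \<longleftrightarrow> image_pt D x = image_pt D y"
    if "x \<in> points D" "y \<in> points D" for x y
    using img in_B that by simp
  have cr: "crossings D' = crossings D"
    unfolding crossings_def pts using same_double_points by blast
  have "curve D' i 0 = curve D i 0" if i: "i \<in> arcs D" for i
  proof -
    have "image_pt D' (i, 0) = H 1 (image_pt D (i, 0))"
      using img i by (auto simp: points_def)
    moreover have "curve D i 0 \<in> frontier B"
      using diagram_arc(2)[OF D i] by simp
    ultimately show ?thesis
      using fix_frontier by (simp add: image_pt_def)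
  qed
  moreover have "all_real D' \<longleftrightarrow> all_real D" "meeting_times D' = meeting_times D"
    by (simp_all add: all_real_def meeting_times_def fun_eq_iff cr eqs)
  ultimately show ?thesis
    using reading eqs unfolding has_reading_def by auto
qed

section \<open>Replacing a part of a diagram\<close>

locale local_replacement =
  fixes B' :: "complex set" and D D' E E' :: tdiagram
    and c :: "nat \<Rightarrow> nat" and \<phi> :: "nat \<Rightarrow> real \<Rightarrow> real"
  assumes arcs_eq: "arcs D' = arcs D"
    and circles_D: "circles D = {}" "circles D' = {}"
    and replacement: "replacement B' E E'"
    and circles_E: "circles E = {}"
    and emb: "embeds c \<phi> E D {x \<in> points D. image_pt D x \<in> B'}"
    and emb': "embeds c \<phi> E' D' {x \<in> points D'. image_pt D' x \<in> B'}"
    and outside: "\<forall>x\<in>points D. image_pt D x \<notin> B' \<longrightarrow>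
       image_pt D' x = image_pt D x \<and> (x \<in> over D' \<longleftrightarrow> x \<in> over D)"
begin

lemma points_eq: "points D' = points D" "points E' = points E"
  using arcs_eq circles_D replacement by (auto simp: points_def replacement_def)

lemma points_E: "points E = arcs E \<times> {0..1}"
  using circles_E by (simp add: points_def)

lemma place_eq [simp]: "place D c \<phi> (k, t) = (c k, \<phi> k t)" "place D' c \<phi> (k, t) = (c k, \<phi> k t)"
  using circles_D by (simp_all add: place_def)

lemma inside_iff_place:
  "x \<in> points D \<and> image_pt D x \<in> B' \<longleftrightarrow> x \<in> place D c \<phi> ` points E"
  using emb unfolding embeds_def bij_betw_def by blast

text \<open>
  Both patches are glued in along the same places, so the same points of the source lie in the
  changing disk before and after the move.
\<close>

lemma inside_iff:
  assumes "x \<in> points D"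
  shows "image_pt D' x \<in> B' \<longleftrightarrow> image_pt D x \<in> B'"
proof -
  have "x \<in> points D' \<and> image_pt D' x \<in> B' \<longleftrightarrow> x \<in> place D' c \<phi> ` points E'"
    using emb' unfolding embeds_def bij_betw_def by blast
  moreover have "place D' c \<phi> = place D c \<phi>"
    by (simp add: place_def fun_eq_iff circles_D)
  ultimately show ?thesis
    using inside_iff_place[of x] points_eq assms by simp
qed

lemma local_replacement_sym: "local_replacement B' D' D E' E c \<phi>"
proof
  show "replacement B' E' E" "circles E' = {}"
    using replacement circles_E by (auto simp: replacement_def)
  show "\<forall>x\<in>points D'. image_pt D' x \<notin> B' \<longrightarrow>
     image_pt D x = image_pt D' x \<and> (x \<in> over D \<longleftrightarrow> x \<in> over D')"
    using outside by (simp add: points_eq inside_iff)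
qed (use arcs_eq circles_D emb emb' in auto)

lemma arc_in_place:
  assumes "k \<in> arcs E" "t \<in> {0..1}"
  shows "(c k, \<phi> k t) \<in> points D" "image_pt D (c k, \<phi> k t) \<in> B'"
  using inside_iff_place[of "(c k, \<phi> k t)"] assms points_E
  by (metis SigmaI image_eqI place_eq(1))+

text \<open>
  If the changing disk contains the start of an arc of \<open>D\<close>, then this is the start of an arc of
  the patch, since the parameter changes are increasing; and the two patches agree there.
\<close>

lemma start_eq:
  assumes i: "i \<in> arcs D"
  shows "curve D' i 0 = curve D i 0"
proof (cases "image_pt D (i, 0) \<in> B'")
  case False
  then show ?thesis
    using bspec[OF outside, of "(i, 0)"] i by (simp add: points_def image_pt_def)
next
  case True
  then have "(i, 0) \<in> place D c \<phi> ` points E"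
    using inside_iff_place[of "(i, 0)"] i by (auto simp: points_def)
  then obtain k t where k: "k \<in> arcs E" and t: "t \<in> {0..1}" and ik: "i = c k" "\<phi> k t = 0"
    unfolding points_E by auto
  have "t = 0"
  proof (rule ccontr)
    assume "t \<noteq> 0"
    moreover have "strict_mono_on {0..1} (\<phi> k)"
      using emb k unfolding embeds_def by auto
    ultimately have "\<phi> k 0 < \<phi> k t"
      using t by (auto simp: strict_mono_on_def)
    moreover have "\<phi> k 0 \<ge> 0"
      using arc_in_place(1)[OF k, of 0] circles_D by (auto simp: points_def)
    ultimately show False
      using ik by simp
  qed
  have "(k, 0) \<in> points E"
    using k points_E by auto
  then have "image_pt E (k, 0) = image_pt D (c k, \<phi> k 0)"
    "image_pt E' (k, 0) = image_pt D' (c k, \<phi> k 0)"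
    using emb emb' points_eq unfolding embeds_def by force+
  moreover have "curve E' k 0 = curve E k 0"
    using replacement k by (auto simp: replacement_def)
  ultimately show ?thesis
    using ik \<open>t = 0\<close> by (simp add: image_pt_def)
qed

text \<open>
  Since the two preimages of a crossing have the same image point, the changing disk cannot
  contain one without the other.
\<close>

lemma crossing_cases:
  assumes cr: "{u, v} \<in> crossings D"
  obtains (outer) "image_pt D u \<notin> B'" "image_pt D v \<notin> B'" "{u, v} \<in> crossings D'"
  | (inner) u' v' where "u = place D c \<phi> u'" "v = place D c \<phi> v'" "{u', v'} \<in> crossings E"
proof (cases "image_pt D u \<in> B'")
  case False
  then show ?thesis
    using cr outside by (intro that(1)) (simp_all add: crossing_iff points_eq)
next
  case True
  then have "u \<in> place D c \<phi> ` points E" "v \<in> place D c \<phi> ` points E"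
    using cr inside_iff_place[of u] inside_iff_place[of v] by (auto simp: crossing_iff)
  then show ?thesis
    using that(2) embeds_crossing_iff[OF emb] cr by blast
qed

lemma all_real_transfer:
  assumes real: "all_real D" "all_real E'"
  shows "all_real D'"
  unfolding all_real_def
proof
  interpret sym: local_replacement B' D' D E' E c \<phi>
    by (rule local_replacement_sym)
  fix e assume "e \<in> crossings D'"
  then obtain u v where e: "e = {u, v}" and uv: "{u, v} \<in> crossings D'"
    by (rule crossingE)
  from uv show "e \<inter> over D' \<noteq> {}"
  proof (cases rule: sym.crossing_cases)
    case outer
    then have "{u, v} \<inter> over D \<noteq> {}"
      using real unfolding all_real_def by blast
    then show ?thesis
      using outer sym.outside uv e by (auto simp: crossing_iff)
  next
    case (inner u' v')
    then have "{u', v'} \<inter> over E' \<noteq> {}"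
      using real unfolding all_real_def by blast
    then show ?thesis
      using embeds_over_iff[OF emb'] inner e by (auto simp: crossing_iff)
  qed
qed

definition patch_times :: "nat \<Rightarrow> nat \<Rightarrow> real set" where
  "patch_times i j = {\<phi> k t | k t l u. c k = i \<and> c l = j \<and> {(k, t), (l, u)} \<in> crossings E'}"

lemma meeting_times_patch:
  assumes none: "crossings E = {}"
  shows "meeting_times D' i j = meeting_times D i j \<union> patch_times i j"
proof (intro equalityI subsetI)
  interpret sym: local_replacement B' D' D E' E c \<phi>
    by (rule local_replacement_sym)
  fix t assume "t \<in> meeting_times D' i j"
  then obtain u where "{(i, t), (j, u)} \<in> crossings D'"
    unfolding meeting_times_def by auto
  then show "t \<in> meeting_times D i j \<union> patch_times i j"
  proof (cases rule: sym.crossing_cases)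
    case outer
    then show ?thesis
      unfolding meeting_times_def by auto
  next
    case (inner u' v')
    then show ?thesis
      unfolding patch_times_def by (cases u'; cases v') auto
  qed
next
  fix t assume "t \<in> meeting_times D i j \<union> patch_times i j"
  then show "t \<in> meeting_times D' i j"
  proof
    assume "t \<in> meeting_times D i j"
    then obtain u where "{(i, t), (j, u)} \<in> crossings D"
      unfolding meeting_times_def by auto
    then show ?thesis
      by (cases rule: crossing_cases) (use none in \<open>auto simp: meeting_times_def\<close>)
  next
    assume "t \<in> patch_times i j"
    then obtain k s l u where kl: "c k = i" "c l = j" "t = \<phi> k s" "{(k, s), (l, u)} \<in> crossings E'"
      unfolding patch_times_def by auto
    then have "{(i, t), (j, \<phi> l u)} \<in> crossings D'"
      using embeds_crossing_iff[OF emb', of "(k, s)" "(l, u)"] by (auto simp: crossing_iff)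
    then show ?thesis
      unfolding meeting_times_def by auto
  qed
qed

text \<open>
  Any parameter between those of two points of one arc of the patch belongs to this arc as well.
  So an arc of the patch without crossings is a stretch of the big arc on which no letter is read.
\<close>

lemma no_meeting_between:
  assumes none: "crossings E = {}" and k: "k \<in> arcs E" and st: "s \<in> {0..1}" "t \<in> {0..1}"
  shows "meeting_times D (c k) j \<inter> {\<phi> k s..\<phi> k t} = {}"
proof (rule ccontr)
  assume "\<not> ?thesis"
  then obtain w where w: "w \<in> meeting_times D (c k) j" and between: "\<phi> k s \<le> w" "w \<le> \<phi> k t"
    by auto
  have cont: "continuous_on {0..1} (\<phi> k)"
    using emb k unfolding embeds_def by auto
  have "connected (\<phi> k ` {0..1})"
    by (rule connected_continuous_image[OF cont]) simp
  then have "w \<in> \<phi> k ` {0..1}"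
    using connectedD_interval[of "\<phi> k ` {0..1}" "\<phi> k s" "\<phi> k t" w] st between by blast
  then obtain v where v: "v \<in> {0..1}" "w = \<phi> k v"
    by auto
  obtain u where "{(c k, w), (j, u)} \<in> crossings D"
    using w unfolding meeting_times_def by auto
  then show False
    by (cases rule: crossing_cases) (use none arc_in_place[OF k v(1)] v in auto)
qed

lemma alternating_count_new_pair:
  assumes none: "crossings E = {}" and fin: "finite (crossings D)"
    and k: "k \<in> arcs E" and st: "s \<in> {0..1}" "t \<in> {0..1}" "s \<noteq> t"
  defines "A \<equiv> meeting_times D (c k)"
  shows "alternating_count (A i \<union> {\<phi> k s, \<phi> k t}) (A j) = alternating_count (A i) (A j)"
    and "alternating_count (A i) (A j \<union> {\<phi> k s, \<phi> k t}) = alternating_count (A i) (A j)"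
proof -
  have mono: "strict_mono_on {0..1} (\<phi> k)"
    using emb k unfolding embeds_def by auto
  obtain u v where uv: "{s, t} = {u, v}" "u < v" "u \<in> {0..1}" "v \<in> {0..1}"
    using st by (metis insert_commute linorder_neqE)
  have lt: "\<phi> k u < \<phi> k v"
    using mono uv by (auto simp: strict_mono_on_def)
  have eq: "{\<phi> k s, \<phi> k t} = {\<phi> k u, \<phi> k v}"
    using uv(1) by (auto simp: doubleton_eq_iff)
  have gap: "(A i \<union> A j) \<inter> {\<phi> k u..\<phi> k v} = {}"
    using no_meeting_between[OF none k uv(3,4)] unfolding A_def by (simp add: Int_Un_distrib2)
  have finA: "finite (A i)" "finite (A j)"
    unfolding A_def using fin by (auto intro: finite_meeting_times)
  show "alternating_count (A i \<union> {\<phi> k s, \<phi> k t}) (A j) = alternating_count (A i) (A j)"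
    unfolding eq by (rule alternating_count_adjacent_left[OF finA lt gap])
  show "alternating_count (A i) (A j \<union> {\<phi> k s, \<phi> k t}) = alternating_count (A i) (A j)"
    unfolding eq by (rule alternating_count_adjacent_right[OF finA lt gap])
qed

lemma alternating_count_type_I:
  assumes R: "(B', E, E') \<in> R_I" and distinct: "x \<noteq> y" "x \<noteq> z"
  shows "alternating_count (meeting_times D' x y) (meeting_times D' x z) =
    alternating_count (meeting_times D x y) (meeting_times D x z)"
proof -
  obtain a s t where none: "crossings E = {}" and cr: "crossings E' = {{(a, s), (a, t)}}"
    using R unfolding R_I_def by auto
  have "patch_times x j = {}" if "x \<noteq> j" for j
    using that cr by (auto simp: patch_times_def doubleton_eq_iff)
  then show ?thesis
    using distinct by (simp add: meeting_times_patch[OF none])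
qed

text \<open>
  The two crossings of a type II move are read along \<open>x\<close> only if one of the two strands lies on
  \<open>x\<close> and the other on \<open>y\<close> or on \<open>z\<close>; either strand can play either part.
\<close>

lemma alternating_count_type_II:
  assumes R: "(B', E, E') \<in> R_II" and fin: "finite (crossings D)" and distinct: "distinct [x, y, z]"
  shows "alternating_count (meeting_times D' x y) (meeting_times D' x z) =
    alternating_count (meeting_times D x y) (meeting_times D x z)"
proof -
  obtain a b s t s' t' where ab: "a \<noteq> b" "s \<noteq> s'" "arcs E = {a, b}" and none: "crossings E = {}"
    and cr: "crossings E' = {{(a, s), (b, t)}, {(a, s'), (b, t')}}"
    using R unfolding R_II_def by auto
  have diag: "diagram B' E'"
    using replacement by (simp add: replacement_def)
  have st: "s \<in> {0..1}" "s' \<in> {0..1}" "t \<in> {0..1}" "t' \<in> {0..1}"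
    using cr crossing_iff[of "(a, s)" "(b, t)" E'] crossing_iff[of "(a, s')" "(b, t')" E']
      points_eq points_E by auto
  have "t \<noteq> t'"
    using no_triple_point[OF diag, of "(b, t)" "(a, s)" "(a, s')"] cr ab
    by (auto simp: insert_commute)
  have patch: "patch_times i j =
      (if c a = i \<and> c b = j then {\<phi> a s, \<phi> a s'} else
       if c b = i \<and> c a = j then {\<phi> b t, \<phi> b t'} else {})" if "i \<noteq> j" for i j
  proof -
    have "{(k, v), (l, w)} \<in> crossings E' \<longleftrightarrow>
        (k, v, l, w) \<in> {(a, s, b, t), (b, t, a, s), (a, s', b, t'), (b, t', a, s')}" for k v l w
      unfolding cr by (auto simp: doubleton_eq_iff)
    then show ?thesis
      using that unfolding patch_times_def by auto
  qed
  have a: "a \<in> arcs E" and b: "b \<in> arcs E"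
    using ab by auto
  note pair_a = alternating_count_new_pair[OF none fin a st(1,2) \<open>s \<noteq> s'\<close>]
  note pair_b = alternating_count_new_pair[OF none fin b st(3,4) \<open>t \<noteq> t'\<close>]
  have xy: "x \<noteq> y" and xz: "x \<noteq> z"
    using distinct by auto
  show ?thesis
    unfolding meeting_times_patch[OF none] patch[OF xy] patch[OF xz]
    using distinct pair_a pair_b by auto
qed

end

section \<open>The effect of the moves\<close>

lemma type_I_all_real:
  assumes "(B, E, E') \<in> R_I"
  shows "all_real E" "all_real E'"
  using assms unfolding R_I_def all_real_def by auto

lemma type_II_all_real:
  assumes "(B, E, E') \<in> R_II"
  shows "all_real E" "all_real E'"
  using assms unfolding R_II_def all_real_def by auto

lemma triangle_sides:
  assumes "triangle E x y z p"
  shows "{(x, p x y), (y, p y x)} \<in> crossings E" "{(x, p x z), (z, p z x)} \<in> crossings E"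
    "{(y, p y z), (z, p z y)} \<in> crossings E"
  using assms unfolding triangle_def by auto

text \<open>
  If two crossings on one arc of a triangle had the same parameter, then all three arcs would
  pass through one point.
\<close>

lemma triangle_params_distinct:
  assumes diag: "diagram B E" and tri: "triangle E x y z p" and distinct: "distinct [x, y, z]"
  shows "p x y \<noteq> p x z" "p y x \<noteq> p y z" "p z x \<noteq> p z y"
proof -
  note sides = triangle_sides[OF tri]
  show "p x y \<noteq> p x z"
    using no_triple_point[OF diag, of "(x, p x y)" "(y, p y x)" "(z, p z x)"] sides distinct
    by auto
  show "p y x \<noteq> p y z"
    using no_triple_point[OF diag, of "(y, p y x)" "(x, p x y)" "(z, p z y)"] sides distinct
    by (auto simp: insert_commute)
  show "p z x \<noteq> p z y"
    using no_triple_point[OF diag, of "(z, p z x)" "(x, p x z)" "(y, p y z)"] sides distinct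
    by (auto simp: insert_commute)
qed

text \<open>
  In both kinds of type IV diagrams the crossing of \<open>y\<close> with \<open>z\<close> is the singular one.
\<close>

lemma singular_side_not_all_real:
  assumes diag: "diagram B E" and tri: "triangle E x y z p" and distinct: "distinct [x, y, z]"
    and over: "over E = {(x, p x y), (x, p x z)} \<or> over E = {(y, p y x), (z, p z x)}"
  shows "\<not> all_real E"
proof
  assume "all_real E"
  then have "{(y, p y z), (z, p z y)} \<inter> over E \<noteq> {}"
    using triangle_sides(3)[OF tri] unfolding all_real_def by blast
  then show False
    using over distinct triangle_params_distinct[OF diag tri distinct] by auto
qed

lemma type_IV_not_all_real:
  assumes "(B, E, E') \<in> R_IV"
  shows "\<not> all_real E" "\<not> all_real E'"
proof -
  obtain x y z p q where "distinct [x, y, z]" "triangle E x y z p" "triangle E' x y z q"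
    "over E = {(x, p x y), (x, p x z)} \<or> over E = {(y, p y x), (z, p z x)}"
    "over E' = {(x, q x y), (x, q x z)} \<or> over E' = {(y, q y x), (z, q z x)}"
    and "diagram B E" "diagram B E'"
    using assms unfolding R_IV_def replacement_def by auto
  then show "\<not> all_real E" "\<not> all_real E'"
    using singular_side_not_all_real by blast+
qed

lemma type_V_not_all_real:
  assumes "(B, E, E') \<in> R_V"
  shows "\<not> all_real E" "\<not> all_real E'"
proof -
  obtain a b r w r' w' where "replacement B E E'"
    and ab: "a \<noteq> b" "r a \<noteq> w a" "r' a \<noteq> w' a"
    and sides: "crossings E = {{(a, r a), (b, r b)}, {(a, w a), (b, w b)}}"
      "crossings E' = {{(a, r' a), (b, r' b)}, {(a, w' a), (b, w' b)}}"
    and over: "over E = {(a, r a)}" "over E' = {(b, r' b)}"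
    using assms unfolding R_V_def mem_Collect_eq prod.case by (elim conjE exE)
  then have diag: "diagram B E'"
    unfolding replacement_def by (elim conjE)
  have cr: "{(a, w a), (b, w b)} \<in> crossings E"
    "{(a, r' a), (b, r' b)} \<in> crossings E'" "{(a, w' a), (b, w' b)} \<in> crossings E'"
    unfolding sides by simp_all
  have "{(a, w a), (b, w b)} \<inter> over E = {}"
    using ab over by auto
  then show "\<not> all_real E"
    using cr(1) unfolding all_real_def by blast
  have "w' b \<noteq> r' b"
    using no_triple_point[OF diag, of "(b, r' b)" "(a, r' a)" "(a, w' a)"] cr ab
    by (auto simp: insert_commute)
  then have "{(a, w' a), (b, w' b)} \<inter> over E' = {}"
    using ab over by auto
  then show "\<not> all_real E'"
    using cr(3) unfolding all_real_def by blast
qed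

lemma has_reading_move_inside:
  assumes D: "diagram B D" and D': "diagram B D'"
    and move: "move_inside (R_I \<union> R_II \<union> R_IV \<union> R_V) B D D'"
    and reading: "has_reading P Q R n D"
  shows "has_reading P Q R n D'"
proof -
  let ?S = "R_I \<union> R_II \<union> R_IV \<union> R_V"
  have circ: "circles D = {}" and real: "all_real D"
    using reading unfolding has_reading_def by auto
  obtain B' E E' c \<phi> where eqs: "arcs D' = arcs D" "circles D' = circles D"
    and S: "(B', E, E') \<in> ?S \<or> (B', E', E) \<in> ?S"
    and emb: "embeds c \<phi> E D {x \<in> points D. image_pt D x \<in> B'}"
      "embeds c \<phi> E' D' {x \<in> points D'. image_pt D' x \<in> B'}"
    and outside: "\<forall>x\<in>points D. image_pt D x \<notin> B' \<longrightarrow>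
       image_pt D' x = image_pt D x \<and> (x \<in> over D' \<longleftrightarrow> x \<in> over D)"
    using move unfolding move_inside_def by (elim conjE exE)
  \<comment> \<open>A diagram with real crossings only contains no side of a type IV or type V move.\<close>
  have "all_real E"
    using embeds_all_real[OF emb(1) real] .
  then have S': "(B', E, E') \<in> R_I \<union> R_II \<or> (B', E', E) \<in> R_I \<union> R_II"
    using S type_IV_not_all_real type_V_not_all_real by blast
  have "replacement B' E E' \<and> circles E = {}"
    using S' unfolding R_I_def R_II_def replacement_def by auto
  then interpret local_replacement B' D D' E E' c \<phi>
    using eqs circ emb outside by unfold_locales auto
  interpret sym: local_replacement B' D' D E' E c \<phi>
    by (rule local_replacement_sym)
  have real': "all_real D'"
    using all_real_transfer[OF real] S' type_I_all_real type_II_all_real by blast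
  have fin: "finite (crossings D)" "finite (crossings D')"
    using D D' by (auto intro: diagram_finite_crossings)
  have count: "alternating_count (meeting_times D' x y) (meeting_times D' x z) =
    alternating_count (meeting_times D x y) (meeting_times D x z)"
    if xyz: "distinct [x, y, z]" for x y z
  proof -
    from xyz have ne: "x \<noteq> y" "x \<noteq> z"
      by auto
    from S' consider "(B', E, E') \<in> R_I" | "(B', E, E') \<in> R_II"
      | "(B', E', E) \<in> R_I" | "(B', E', E) \<in> R_II"
      by blast
    then show ?thesis
    proof cases
      case 1
      then show ?thesis
        using ne by (rule alternating_count_type_I)
    next
      case 2
      then show ?thesis
        using fin(1) xyz by (rule alternating_count_type_II)
    next
      case 3
      then show ?thesis
        using sym.alternating_count_type_I[OF _ ne] by simp
    next
      case 4
      then show ?thesis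
        using sym.alternating_count_type_II[OF _ fin(2) xyz] by simp
    qed
  qed
  obtain x y z where xyz: "x \<in> arcs D" "y \<in> arcs D" "z \<in> arcs D" "distinct [x, y, z]"
    "curve D x 0 = P" "curve D y 0 = Q" "curve D z 0 = R"
    and n: "alternating_count (meeting_times D x y) (meeting_times D x z) = n"
    using reading unfolding has_reading_def by auto
  have "curve D' x 0 = P" "curve D' y 0 = Q" "curve D' z 0 = R"
    using start_eq xyz by auto
  then show ?thesis
    using xyz(1-4) arcs_eq circles_D(2) real' count[OF xyz(4)] n unfolding has_reading_def by metis
qed

lemma has_reading_step:
  assumes "step (R_I \<union> R_II \<union> R_IV \<union> R_V) B D D'" "has_reading P Q R n D"
  shows "has_reading P Q R n D'"
proof -
  have D: "diagram B D" "diagram B D'"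
    and "reparametrized D D' \<or> planar_isotopic B D D' \<or>
      move_inside (R_I \<union> R_II \<union> R_IV \<union> R_V) B D D'"
    using assms(1) unfolding step_def by simp_all
  then show ?thesis
    using has_reading_reparametrized[OF D _ assms(2)]
      has_reading_planar_isotopic[OF D(1) _ assms(2)]
      has_reading_move_inside[OF D _ assms(2)] by auto
qed

lemma triangle_meeting_times:
  assumes "triangle E x y z p" "distinct [x, y, z]"
  shows "meeting_times E x y = {p x y}" "meeting_times E x z = {p x z}"
  using assms unfolding triangle_def meeting_times_def by (auto simp: doubleton_eq_iff)

theorem theorem2p13:
  fixes m :: local_move
  assumes "m \<in> R_III"
  shows "\<not> m \<prec> (R_I \<union> R_II \<union> R_IV \<union> R_V)"
proof
  let ?S = "R_I \<union> R_II \<union> R_IV \<union> R_V"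
  assume gen: "m \<prec> ?S"
  obtain B E E' where m: "m = (B, E, E')"
    by (metis prod_cases3)
  obtain x y z p q where rep: "replacement B E E'" and circ: "circles E = {}"
    and xyz: "distinct [x, y, z]" and arcs: "arcs E = {x, y, z}"
    and tri: "triangle E x y z p" and tri': "triangle E' x y z q" and slid: "slid x y z p q"
    and over: "over E = {(x, p x y), (x, p x z), (y, p y z)}"
    using assms unfolding m R_III_def by auto
  have diag: "diagram B E" and diag': "diagram B E'" and arcs': "arcs E' = arcs E"
    and starts: "\<And>i. i \<in> arcs E \<Longrightarrow> curve E' i 0 = curve E i 0"
    using rep unfolding replacement_def by auto
  let ?n = "alternating_count {p x y} {p x z}"
  let ?reading = "has_reading (curve E x 0) (curve E y 0) (curve E z 0) ?n"
  have "all_real E"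
    using tri over unfolding all_real_def triangle_def by auto
  moreover have "x \<in> arcs E \<and> y \<in> arcs E \<and> z \<in> arcs E \<and>
      alternating_count (meeting_times E x y) (meeting_times E x z) = ?n"
    using arcs triangle_meeting_times[OF tri xyz] by simp
  ultimately have reading: "?reading E"
    using circ xyz unfolding has_reading_def by blast
  have "(step ?S B)\<^sup>*\<^sup>* E E'"
    using gen unfolding generated_by_def m by simp
  then have "?reading E'"
  proof (induction rule: rtranclp_induct)
    case base
    show ?case
      by (rule reading)
  next
    case (step D D')
    from step.hyps(2) step.IH show ?case
      by (rule has_reading_step)
  qed
  then obtain x' y' z' where labels: "x' \<in> arcs E'" "y' \<in> arcs E'" "z' \<in> arcs E'"
    and starts': "curve E' x' 0 = curve E x 0" "curve E' y' 0 = curve E y 0"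
      "curve E' z' 0 = curve E z 0"
    and n: "alternating_count (meeting_times E' x' y') (meeting_times E' x' z') = ?n"
    unfolding has_reading_def by auto
  have "x' = x" "y' = y" "z' = z"
    using labels[THEN arc_start_inj[OF diag']] starts' starts[of x] starts[of y] starts[of z]
    by (simp_all add: arcs arcs')
  then have same: "alternating_count {q x y} {q x z} = ?n"
    using n triangle_meeting_times[OF tri' xyz] by simp
  have p: "p x y \<noteq> p x z" and q: "q x y \<noteq> q x z"
    using triangle_params_distinct(1)[OF diag tri xyz]
      triangle_params_distinct(1)[OF diag' tri' xyz] by simp_all
  have "(if q x y < q x z then 1 else - 1 :: int) = (if p x y < p x z then 1 else - 1)"
    using same unfolding alternating_count_singletons[OF p] alternating_count_singletons[OF q] .
  then have "q x y < q x z \<longleftrightarrow> p x y < p x z"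
    by (simp split: if_splits)
  moreover have "p x y < p x z \<longleftrightarrow> q x z < q x y"
    using slid unfolding slid_def by (elim conjE)
  ultimately show False
    using q by linarith
qed

end
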